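(* Suppose $B$ intersects $A$ $rl$-transversally at $\bar x\in A\cap B$, and the $rl$-three-point inequality is satisfied at $\bar x$. Then there exists a neighborhood $V$ of $\bar x$ such that every Bregman alternating sequence between $A$ and $B$ which enters $V$ (i.e. one of whose iterates $a_k$ or $b_k$ belongs to $V$) converges to some point in the intersection $A\cap B$ with R-linear speed.
   Context: Setting: $f:\mathbb R^d\to\mathbb R\cup\{+\infty\}$ is a convex function of Legendre type (in Rockafellar's sense), $G:=\mathrm{int}(\mathrm{dom} f)$, $f$ is of class $C^2$ on $G$ and $\nabla^2f(x)\succ0$ for all $x\in G$. The Bregman distance is $D(x,y)=f(x)-f(y)-\langle\nabla f(y),x-y\rangle$ for $y\in G$ and $D(x,y)=+\infty$ otherwise. $A,B\subset G$ are nonempty, closed and bounded. Projections: $\overleftarrow{P}_B(a)=\mathrm{argmin}\{D(b',a):b'\in B\}$; $\overrightarrow{P}_A(b)=\mathrm{argmin}\{D(b,a'):a'\in A\}$ (set-valued). A Bregman alternating sequence is $a_k\in A$, $b_k\in B$ with $b_k\in\overleftarrow{P}_B(a_k)$, $a_{k+1}\in\overrightarrow{P}_A(b_k)$ for all $k$; it converges to $x$ if $a_k\to x$ and $b_k\to x$. An $rl$-building block $b\to a^+\to b^+$ consists of $b\in B$, $a^+\in\overrightarrow{P}_A(b)$, $b^+\in\overleftarrow{P}_B(a^+)$; it is in $U$ if $b,a^+,b^+\in U$. $B$ intersects $A$ $rl$-transversally at $\bar x\in A\cap B$ if there exist a neighborhood $U$ of $\bar x$ and $\underline\alpha>0$ such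 that for every $rl$-building block $b\to a^+\to b^+$ in $U$ (with $b\ne a^+\neq b^+$, so that the angle is defined) the angle $\alpha$ between $b-a^+$ and $b^+-a^+$ is larger than $\underline\alpha$. $rl$-three-point inequality at $\bar x$: there exist $\ell\in(0,1)$ and $\delta>0$ such that $D(b,a^+)\ge D(b^+,a^+)+\ell D(b,b^+)$ for every $rl$-building block $b\to a^+\to b^+$ with $\|b^+-\bar x\|<\delta$, $\|a^+-\bar x\|<\delta$. R-linear speed of $x_k\to x$ means $\|x_k-x\|\le Cq^k$ for some $C>0$, $q\in(0,1)$. *)

theory Defs
  imports "HOL-Analysis.Analysis"
begin

text \<open>A convex function with values in the reals extended by plus infinity is modelled as an
  \<open>ereal\<close>-valued function that never takes the value minus infinity.\<close>

definition effective_domain :: "('a \<Rightarrow> ereal) \<Rightarrow> 'a set" where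
  "effective_domain f = {x. f x < \<infinity>}"

definition int_dom :: "('a::euclidean_space \<Rightarrow> ereal) \<Rightarrow> 'a set" where
  "int_dom f = interior (effective_domain f)"

definition ereal_convex :: "('a::euclidean_space \<Rightarrow> ereal) \<Rightarrow> bool" where
  "ereal_convex f \<longleftrightarrow> convex {(x, r::real). f x \<le> ereal r}"

text \<open>Near a point of \<open>int_dom f\<close> the function \<open>f\<close> is finite, so that derivatives of \<open>f\<close>
  there are those of the real-valued function \<open>fin f\<close>.\<close>

definition fin :: "('a \<Rightarrow> ereal) \<Rightarrow> 'a \<Rightarrow> real" where
  "fin f x = real_of_ereal (f x)"

definition grad :: "('a::euclidean_space \<Rightarrow> ereal) \<Rightarrow> 'a \<Rightarrow> 'a" where
  "grad f x = (THE g. GDERIV (fin f) x :> g)"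

definition hess :: "('a::euclidean_space \<Rightarrow> ereal) \<Rightarrow> 'a \<Rightarrow> 'a \<Rightarrow> 'a" where
  "hess f x = frechet_derivative (grad f) (at x)"

text \<open>Rockafellar, \<^emph>\<open>Convex Analysis\<close>, Section 26: the pair \<open>(int_dom f, f)\<close> is of Legendre type.
  As in that definition, lower semicontinuity of \<open>f\<close> is not part of it.\<close>

definition legendre_type :: "('a::euclidean_space \<Rightarrow> ereal) \<Rightarrow> bool" where
  "legendre_type f \<longleftrightarrow>
     (\<forall>x. f x \<noteq> -\<infinity>) \<and> ereal_convex f \<and> int_dom f \<noteq> {} \<and>
     (\<forall>x\<in>int_dom f. fin f differentiable (at x)) \<and>
     (\<forall>x\<in>int_dom f. \<forall>y\<in>int_dom f. \<forall>t::real. x \<noteq> y \<longrightarrow> 0 < t \<longrightarrow> t < 1 \<longrightarrow>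
        fin f ((1 - t) *\<^sub>R x + t *\<^sub>R y) < (1 - t) * fin f x + t * fin f y) \<and>
     (\<forall>X z. (\<forall>n::nat. X n \<in> int_dom f) \<longrightarrow> z \<in> frontier (int_dom f) \<longrightarrow> X \<longlonglongrightarrow> z \<longrightarrow>
        filterlim (\<lambda>n. norm (grad f (X n))) at_top sequentially)"

definition C2_on_int_dom :: "('a::euclidean_space \<Rightarrow> ereal) \<Rightarrow> bool" where
  "C2_on_int_dom f \<longleftrightarrow>
     (\<forall>x\<in>int_dom f. fin f differentiable (at x)) \<and>
     (\<forall>x\<in>int_dom f. grad f differentiable (at x)) \<and>
     (\<forall>h. continuous_on (int_dom f) (\<lambda>x. hess f x h))"

definition hess_pos_def :: "('a::euclidean_space \<Rightarrow> ereal) \<Rightarrow> bool" where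
  "hess_pos_def f \<longleftrightarrow> (\<forall>x\<in>int_dom f. \<forall>h. h \<noteq> 0 \<longrightarrow> 0 < hess f x h \<bullet> h)"

definition bregman :: "('a::euclidean_space \<Rightarrow> ereal) \<Rightarrow> 'a \<Rightarrow> 'a \<Rightarrow> ereal" where
  "bregman f x y =
     (if y \<in> int_dom f then f x - f y - ereal (grad f y \<bullet> (x - y)) else \<infinity>)"

definition left_proj :: "('a::euclidean_space \<Rightarrow> ereal) \<Rightarrow> 'a set \<Rightarrow> 'a \<Rightarrow> 'a set" where
  "left_proj f B a = {b. is_arg_min (\<lambda>b'. bregman f b' a) (\<lambda>b'. b' \<in> B) b}"

definition right_proj :: "('a::euclidean_space \<Rightarrow> ereal) \<Rightarrow> 'a set \<Rightarrow> 'a \<Rightarrow> 'a set" where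
  "right_proj f A b = {a. is_arg_min (\<lambda>a'. bregman f b a') (\<lambda>a'. a' \<in> A) a}"

definition bregman_alternating ::
    "('a::euclidean_space \<Rightarrow> ereal) \<Rightarrow> 'a set \<Rightarrow> 'a set \<Rightarrow> (nat \<Rightarrow> 'a) \<Rightarrow> (nat \<Rightarrow> 'a) \<Rightarrow> bool" where
  "bregman_alternating f A B a b \<longleftrightarrow>
     (\<forall>k. a k \<in> A \<and> b k \<in> B \<and> b k \<in> left_proj f B (a k) \<and> a (Suc k) \<in> right_proj f A (b k))"

definition rl_block ::
    "('a::euclidean_space \<Rightarrow> ereal) \<Rightarrow> 'a set \<Rightarrow> 'a set \<Rightarrow> 'a \<Rightarrow> 'a \<Rightarrow> 'a \<Rightarrow> bool" where
  "rl_block f A B b a' b' \<longleftrightarrow> b \<in> B \<and> a' \<in> right_proj f A b \<and> b' \<in> left_proj f B a'"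

text \<open>Only meaningful for nonzero arguments.\<close>

definition angle_between :: "'a::euclidean_space \<Rightarrow> 'a \<Rightarrow> real" where
  "angle_between u v = arccos (u \<bullet> v / (norm u * norm v))"

definition rl_transversal ::
    "('a::euclidean_space \<Rightarrow> ereal) \<Rightarrow> 'a set \<Rightarrow> 'a set \<Rightarrow> 'a \<Rightarrow> bool" where
  "rl_transversal f A B xbar \<longleftrightarrow>
     (\<exists>U \<alpha>. open U \<and> xbar \<in> U \<and> \<alpha> > 0 \<and>
        (\<forall>b a' b'. rl_block f A B b a' b' \<longrightarrow> b \<in> U \<longrightarrow> a' \<in> U \<longrightarrow> b' \<in> U \<longrightarrow>
           b \<noteq> a' \<longrightarrow> a' \<noteq> b' \<longrightarrow> angle_between (b - a') (b' - a') > \<alpha>))"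

definition rl_three_point ::
    "('a::euclidean_space \<Rightarrow> ereal) \<Rightarrow> 'a set \<Rightarrow> 'a set \<Rightarrow> 'a \<Rightarrow> bool" where
  "rl_three_point f A B xbar \<longleftrightarrow>
     (\<exists>(l::real) \<delta>. 0 < l \<and> l < 1 \<and> 0 < \<delta> \<and>
        (\<forall>b a' b'. rl_block f A B b a' b' \<longrightarrow> norm (b' - xbar) < \<delta> \<longrightarrow> norm (a' - xbar) < \<delta> \<longrightarrow>
           bregman f b a' \<ge> bregman f b' a' + ereal l * bregman f b b'))"

definition R_linear :: "(nat \<Rightarrow> 'a::euclidean_space) \<Rightarrow> 'a \<Rightarrow> bool" where
  "R_linear X x \<longleftrightarrow> (\<exists>C q. 0 < C \<and> 0 < q \<and> q < 1 \<and> (\<forall>k. norm (X k - x) \<le> C * q ^ k))"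

end

theory Submission
  imports Defs
begin

text \<open>On the compact convex hull of \<open>A \<union> B\<close> the Hessian is bounded above and away from zero, so
  \<open>m |x - y|\<^sup>2 \<le> D(x, y) \<le> M |x - y|\<^sup>2\<close> there. Transversality gives
  \<open>|b - b\<^sup>+|\<^sup>2 \<ge> (1 - cos \<alpha>) |b - a\<^sup>+|\<^sup>2\<close>, and with these bounds the three-point inequality becomes a
  contraction \<open>D(b\<^sup>+, a\<^sup>+) \<le> q D(b, a\<^sup>+)\<close> for building blocks near \<open>xbar\<close>. Since
  \<open>D(b, a\<^sup>+) \<le> D(b, a)\<close>, the distances \<open>D(b\<^sub>k, a\<^sub>k)\<close> decay geometrically and the steps
  \<open>|b\<^sub>k\<^sub>+\<^sub>1 - b\<^sub>k|\<close> are summable; a sequence that enters a small enough ball therefore never leaves the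
  region where the contraction holds.\<close>

section \<open>Real-valued Bregman distance and the gradient\<close>

definition breg :: "('a::euclidean_space \<Rightarrow> ereal) \<Rightarrow> 'a \<Rightarrow> 'a \<Rightarrow> real" where
  "breg f x y = fin f x - fin f y - grad f y \<bullet> (x - y)"

text \<open>The effective domain is the projection of the epigraph under \<open>fst\<close>, so
  convexity passes to it and then to its interior. This is what keeps the convex hull of
  \<open>A\<close> and \<open>B\<close> inside \<open>int_dom f\<close>.\<close>

lemma convex_int_dom:
  assumes "ereal_convex f" and "\<And>x. f x \<noteq> -\<infinity>"
  shows "convex (int_dom f)"
proof -
  have "effective_domain f = fst ` {(x, r::real). f x \<le> ereal r}"
  proof (intro set_eqI iffI)
    fix x assume "x \<in> effective_domain f"
    then have "f x = ereal (fin f x)"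
      using assms(2)[of x] by (cases "f x") (auto simp: effective_domain_def fin_def)
    then have "(x, fin f x) \<in> {(x, r::real). f x \<le> ereal r}"
      by simp
    then show "x \<in> fst ` {(x, r::real). f x \<le> ereal r}"
      by (metis fst_conv image_eqI)
  next
    fix x assume "x \<in> fst ` {(x, r::real). f x \<le> ereal r}"
    then show "x \<in> effective_domain f"
      by (auto simp: effective_domain_def)
  qed
  moreover have "convex (fst ` {(x, r::real). f x \<le> ereal r})"
    using assms(1) unfolding ereal_convex_def by (intro convex_linear_image linear_fst)
  ultimately show ?thesis
    unfolding int_dom_def by (simp add: convex_interior)
qed

lemma bregman_eq_breg:
  assumes "\<And>x. f x \<noteq> -\<infinity>" and "x \<in> int_dom f" and "y \<in> int_dom f"
  shows "bregman f x y = ereal (breg f x y)"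
proof -
  have "f z = ereal (fin f z)" if "z \<in> int_dom f" for z
    using that interior_subset[of "effective_domain f"] assms(1)[of z]
    by (cases "f z") (auto simp: int_dom_def effective_domain_def fin_def)
  then show ?thesis
    using assms(2,3) by (simp add: bregman_def breg_def)
qed

text \<open>Since \<open>grad\<close> is a definite description, existence and uniqueness of the
  gradient must be established before anything can be said about it.\<close>

lemma GDERIV_grad:
  assumes "fin f differentiable (at x)"
  shows "GDERIV (fin f) x :> grad f x"
proof -
  obtain D where D: "(fin f has_derivative D) (at x)"
    using assms by (auto simp: differentiable_def)
  have lin: "linear D"
    using D has_derivative_linear by blast
  \<comment> \<open>\<open>adjoint D 1\<close> is the Riesz representative of the functional
    \<open>D\<close>, hence the candidate for the gradient.\<close>
  have "D = (\<lambda>h. h \<bullet> adjoint D 1)"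
    using adjoint_works[OF lin, of _ 1] by auto
  then have ex: "GDERIV (fin f) x :> adjoint D 1"
    using D unfolding gderiv_def by simp
  have uniq: "g = g'" if "GDERIV (fin f) x :> g" "GDERIV (fin f) x :> g'" for g g'
    using has_derivative_unique[OF that[unfolded gderiv_def]] by (metis vector_eq_ldot)
  show ?thesis
    unfolding grad_def using ex uniq[OF _ ex] by (rule theI)
qed

section \<open>Quadratic bounds on the Bregman distance from the Hessian\<close>

lemma breg_eq_hess:
  assumes f: "C2_on_int_dom f" and K: "convex K" "K \<subseteq> int_dom f" and x: "x \<in> K" and y: "y \<in> K"
  obtains z where "z \<in> K" and "breg f x y = hess f z (x - y) \<bullet> (x - y) / 2"
proof -
  define p where "p t = y + t *\<^sub>R (x - y)" for t :: real
  have p: "p t \<in> K" if "0 \<le> t" "t \<le> 1" for t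
    using convexD_alt[OF K(1) y x that] by (simp add: p_def algebra_simps)
  have p': "(p has_derivative (\<lambda>s. s *\<^sub>R (x - y))) (at t)" for t
    unfolding p_def by (auto intro!: derivative_eq_intros)
  \<comment> \<open>Indices 0, 1, 2 are the successive derivatives of \<open>fin f\<close> along the
    segment from \<open>y\<close> to \<open>x\<close>. The Lagrange remainder of order two at
    \<open>t = 1\<close> is then the Bregman distance, because the terms of order 0 and 1 are
    exactly what \<open>breg\<close> subtracts.\<close>
  define \<phi> where "\<phi> n t = (if n = 0 then fin f (p t) else if n = 1 then grad f (p t) \<bullet> (x - y)
     else hess f (p t) (x - y) \<bullet> (x - y))" for n :: nat and t
  have d0: "DERIV (\<phi> 0) t :> \<phi> 1 t" if t: "0 \<le> t" "t \<le> 1" for t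
  proof -
    have "fin f differentiable (at (p t))"
      using f p[OF t] K by (auto simp: C2_on_int_dom_def)
    then have "(fin f has_derivative (\<lambda>h. h \<bullet> grad f (p t))) (at (p t))"
      using GDERIV_grad gderiv_def by blast
    from has_derivative_compose[OF p' this] show ?thesis
      by (simp add: \<phi>_def[abs_def] has_field_derivative_def inner_commute mult.commute[of _ "_ \<bullet> _"] cong: if_cong)
  qed
  have d1: "DERIV (\<phi> 1) t :> \<phi> 2 t" if t: "0 \<le> t" "t \<le> 1" for t
  proof -
    have "grad f differentiable (at (p t))"
      using f p[OF t] K by (auto simp: C2_on_int_dom_def)
    then have h: "(grad f has_derivative hess f (p t)) (at (p t))"
      unfolding hess_def by (simp add: frechet_derivative_works)
    then have "hess f (p t) (s *\<^sub>R v) = s *\<^sub>R hess f (p t) v" for s v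
      using has_derivative_linear linear_scale by blast
    with has_derivative_inner_left[OF has_derivative_compose[OF p' h], of "x - y"] show ?thesis
      by (simp add: \<phi>_def[abs_def] has_field_derivative_def mult.commute[of _ "_ \<bullet> _"] cong: if_cong)
  qed
  have "\<forall>m t. m < 2 \<and> 0 \<le> t \<and> t \<le> 1 \<longrightarrow> DERIV (\<phi> m) t :> \<phi> (Suc m) t"
    using d0 d1 by (auto simp: less_2_cases_iff numeral_2_eq_2[symmetric])
  from Maclaurin[OF _ _ refl this] obtain t where t: "0 < t" "t < 1"
    and e: "\<phi> 0 1 = (\<Sum>m<2. \<phi> m 0 / fact m * 1 ^ m) + \<phi> 2 t / fact 2 * 1 ^ 2"
    by auto
  have "breg f x y = hess f (p t) (x - y) \<bullet> (x - y) / 2"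
    using e by (simp add: \<phi>_def breg_def p_def numeral_2_eq_2)
  then show ?thesis
    using that p[of t] t by auto
qed

text \<open>The Hessian form attains a positive minimum and a maximum over the compact set of pairs
  of a point of \<open>K\<close> and a unit vector. Homogeneity of degree two carries both to
  arbitrary vectors, and the Taylor remainder halves them.\<close>

lemma breg_bounds:
  fixes K :: "'a::euclidean_space set"
  assumes f: "C2_on_int_dom f" "hess_pos_def f"
    and K: "convex K" "K \<subseteq> int_dom f" "compact K" "K \<noteq> {}"
  obtains m M :: real where "0 < m" and "0 < M"
    and "\<And>x y. x \<in> K \<Longrightarrow> y \<in> K \<Longrightarrow> m * (norm (x - y))\<^sup>2 \<le> breg f x y"
    and "\<And>x y. x \<in> K \<Longrightarrow> y \<in> K \<Longrightarrow> breg f x y \<le> M * (norm (x - y))\<^sup>2"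
proof -
  define Q where "Q z = hess f (fst z) (snd z) \<bullet> snd z" for z
  let ?S = "K \<times> sphere (0 :: 'a) 1"
  have lin: "linear (hess f x)" if "x \<in> K" for x
  proof -
    have "grad f differentiable (at x)"
      using f K that by (auto simp: C2_on_int_dom_def)
    then show ?thesis
      unfolding hess_def using frechet_derivative_works has_derivative_linear by blast
  qed
  \<comment> \<open>\<open>C2_on_int_dom\<close> gives continuity of \<open>hess f x h\<close> in
    \<open>x\<close> only for each fixed \<open>h\<close>. Expanding the direction in the basis
    turns this into joint continuity of \<open>Q\<close>.\<close>
  have Q: "Q z = (\<Sum>i\<in>Basis. (snd z \<bullet> i) * (hess f (fst z) i \<bullet> snd z))" if "z \<in> ?S" for z
  proof -
    have "hess f (fst z) (\<Sum>i\<in>Basis. (snd z \<bullet> i) *\<^sub>R i) = (\<Sum>i\<in>Basis. (snd z \<bullet> i) *\<^sub>R hess f (fst z) i)"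
      using lin[of "fst z"] that by (auto simp: linear_sum linear_scale)
    then show ?thesis
      unfolding Q_def by (simp add: euclidean_representation inner_sum_left)
  qed
  have h: "continuous_on ?S (\<lambda>z. hess f (fst z) i)" for i
  proof (rule continuous_on_compose2[of K "\<lambda>x. hess f x i" ?S fst])
    show "continuous_on K (\<lambda>x. hess f x i)"
      using f K by (auto simp: C2_on_int_dom_def intro: continuous_on_subset)
  qed (auto intro: continuous_intros)
  have "continuous_on ?S (\<lambda>z. \<Sum>i\<in>Basis. (snd z \<bullet> i) * (hess f (fst z) i \<bullet> snd z))"
    by (intro continuous_intros h)
  then have cont: "continuous_on ?S Q"
    using Q by (simp cong: continuous_on_cong)
  have comp: "compact ?S"
    using K(3) by (intro compact_Times compact_sphere)
  have "(SOME i. i \<in> Basis) \<in> sphere (0 :: 'a) 1"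
    by (simp add: SOME_Basis)
  then have ne: "?S \<noteq> {}"
    using K(4) by blast
  obtain z0 where z0: "z0 \<in> ?S" "\<And>z. z \<in> ?S \<Longrightarrow> Q z0 \<le> Q z"
    using continuous_attains_inf[OF comp ne cont] by auto
  obtain z1 where z1: "z1 \<in> ?S" "\<And>z. z \<in> ?S \<Longrightarrow> Q z \<le> Q z1"
    using continuous_attains_sup[OF comp ne cont] by auto
  have pos: "0 < Q z" if "z \<in> ?S" for z
  proof -
    have "fst z \<in> int_dom f" "snd z \<noteq> 0"
      using that K(2) by auto
    then show ?thesis
      using f(2) by (simp add: hess_pos_def_def Q_def)
  qed
  have hom: "hess f x v \<bullet> v = Q (x, v /\<^sub>R norm v) * (norm v)\<^sup>2" if "x \<in> K" "v \<noteq> 0" for x v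
    using that lin[of x] by (simp add: Q_def linear_scale power2_eq_square field_simps)
  have low: "Q z0 * (norm v)\<^sup>2 \<le> hess f x v \<bullet> v" and up: "hess f x v \<bullet> v \<le> Q z1 * (norm v)\<^sup>2"
    if "x \<in> K" for x v
  proof -
    have "Q z0 * (norm v)\<^sup>2 \<le> hess f x v \<bullet> v \<and> hess f x v \<bullet> v \<le> Q z1 * (norm v)\<^sup>2"
    proof (cases "v = 0")
      case False
      then have "(x, v /\<^sub>R norm v) \<in> ?S"
        using that by simp
      from z0(2)[OF this] z1(2)[OF this] show ?thesis
        unfolding hom[OF that False] by (intro conjI mult_right_mono) auto
    qed simp
    then show "Q z0 * (norm v)\<^sup>2 \<le> hess f x v \<bullet> v" "hess f x v \<bullet> v \<le> Q z1 * (norm v)\<^sup>2"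
      by auto
  qed
  show thesis
  proof (rule that[of "Q z0 / 2" "Q z1 / 2"])
    fix x y assume "x \<in> K" "y \<in> K"
    then obtain z where "z \<in> K" and "breg f x y = hess f z (x - y) \<bullet> (x - y) / 2"
      using breg_eq_hess[OF f(1) K(1,2)] by blast
    then show "Q z0 / 2 * (norm (x - y))\<^sup>2 \<le> breg f x y" "breg f x y \<le> Q z1 / 2 * (norm (x - y))\<^sup>2"
      using low[of z "x - y"] up[of z "x - y"] by auto
  qed (use pos z0(1) z1(1) in auto)
qed

section \<open>Angles, and sequences with geometric decay\<close>

lemma angle_bound_norm_diff:
  fixes u v :: "'a::euclidean_space"
  assumes "u \<noteq> 0" "v \<noteq> 0" and "\<alpha> < angle_between u v" and "0 \<le> \<alpha>" and "\<alpha> \<le> pi / 2"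
  shows "(1 - cos \<alpha>) * (norm u)\<^sup>2 \<le> (norm (u - v))\<^sup>2"
proof -
  define t where "t = u \<bullet> v / (norm u * norm v)"
  have "\<bar>t\<bar> \<le> 1"
    using Cauchy_Schwarz_ineq2[of u v] assms(1,2) by (simp add: t_def divide_le_eq)
  then have t: "-1 \<le> t" "t \<le> 1"
    by auto
  have "cos (arccos t) \<le> cos \<alpha>"
    using assms(3,4) arccos_ubound[OF t] unfolding angle_between_def t_def[symmetric]
    by (intro cos_monotone_0_pi_le) auto
  then have "t \<le> cos \<alpha>"
    using t by simp
  then have uv: "u \<bullet> v \<le> cos \<alpha> * (norm u * norm v)"
    using assms(1,2) by (simp add: t_def divide_le_eq)
  have c: "0 \<le> cos \<alpha>" "cos \<alpha> \<le> 1"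
    using assms(4,5) by (auto intro: cos_ge_zero)
  \<comment> \<open>This expression is the law-of-cosines bound \<open>(norm u)\<^sup>2 + (norm
    v)\<^sup>2 - 2 * cos \<alpha> * norm u * norm v\<close> minus
    \<open>(1 - cos \<alpha>) * (norm u)\<^sup>2\<close>. It is nonnegative because
    \<open>\<alpha>\<close> is at most a right angle, so both coefficients are nonnegative.\<close>
  have "0 \<le> cos \<alpha> * (norm u - norm v)\<^sup>2 + (1 - cos \<alpha>) * (norm v)\<^sup>2"
    using c by simp
  then have "(1 - cos \<alpha>) * (norm u)\<^sup>2 \<le> (norm u)\<^sup>2 + (norm v)\<^sup>2 - 2 * (cos \<alpha> * (norm u * norm v))"
    by (simp add: power2_eq_square algebra_simps)
  also have "\<dots> \<le> (norm u)\<^sup>2 + (norm v)\<^sup>2 - 2 * (u \<bullet> v)"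
    using uv by simp
  also have "\<dots> = (norm (u - v))\<^sup>2"
    by (simp add: power2_norm_eq_inner inner_diff inner_commute)
  finally show ?thesis .
qed

lemma geometric_steps_converge:
  fixes X :: "nat \<Rightarrow> 'a::euclidean_space"
  assumes "0 \<le> r" "r < 1" and step: "\<And>n. norm (X (Suc n) - X n) \<le> C * r ^ n"
  obtains x where "X \<longlonglongrightarrow> x" and "\<And>n. norm (X n - x) \<le> C / (1 - r) * r ^ n"
proof -
  \<comment> \<open>The factor \<open>1 - r ^ k\<close> makes the right-hand side the exact partial
    geometric sum, which is what lets the induction close.\<close>
  have tail: "norm (X (n + k) - X n) \<le> C / (1 - r) * r ^ n * (1 - r ^ k)" for n k
  proof (induction k)
    case (Suc k)
    have "norm (X (n + Suc k) - X n) \<le> norm (X (Suc (n + k)) - X (n + k)) + norm (X (n + k) - X n)"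
      using norm_triangle_ineq[of "X (Suc (n + k)) - X (n + k)" "X (n + k) - X n"] by simp
    also have "\<dots> \<le> C * r ^ (n + k) + C / (1 - r) * r ^ n * (1 - r ^ k)"
      using step Suc by (rule add_mono)
    also have "\<dots> = C / (1 - r) * r ^ n * (1 - r ^ Suc k)"
      using assms(2) by (simp add: field_simps power_add)
    finally show ?case .
  qed simp
  have "summable (\<lambda>n. X (Suc n) - X n)"
    using assms by (intro summable_comparison_test'[OF summable_mult[OF summable_geometric], of r]) auto
  then have "convergent (\<lambda>n. X n - X 0)"
    by (simp add: summable_iff_convergent sum_lessThan_telescope)
  then have "convergent X"
    using convergent_add[OF _ convergent_const[of "X 0"]] by fastforce
  then obtain x where x: "X \<longlonglongrightarrow> x"
    by (auto simp: convergent_def)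
  have "norm (X n - x) \<le> C / (1 - r) * r ^ n" for n
  proof (rule tendsto_upperbound)
    show "(\<lambda>k. norm (X n - X (k + n))) \<longlonglongrightarrow> norm (X n - x)"
      by (intro tendsto_intros LIMSEQ_ignore_initial_segment x)
    have "0 \<le> C"
      using order_trans[OF norm_ge_zero step[of 0]] by simp
    then have "C / (1 - r) * r ^ n * (1 - r ^ k) \<le> C / (1 - r) * r ^ n * 1" for k
      using assms(1,2) by (intro mult_left_mono) auto
    then show "\<forall>\<^sub>F k in sequentially. norm (X n - X (k + n)) \<le> C / (1 - r) * r ^ n"
      using order_trans[OF tail[of n]] by (auto simp: add.commute norm_minus_commute intro!: always_eventually)
  qed simp
  with x show thesis
    using that by blast
qed

lemma R_linear_shift:
  assumes "0 < r" "r < 1" and b: "\<And>n. norm (X (n + N) - x) \<le> C * r ^ n"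
  shows "R_linear X x"
proof -
  \<comment> \<open>The first summand absorbs the index shift, the finite sum dominates each of the
    initial terms, and the final 1 makes the constant strictly positive.\<close>
  define E where "E = \<bar>C\<bar> / r ^ N + (\<Sum>k<N. norm (X k - x) / r ^ k) + 1"
  have S: "0 \<le> (\<Sum>k<N. norm (X k - x) / r ^ k)"
    using assms(1) by (intro sum_nonneg) auto
  have "norm (X k - x) \<le> E * r ^ k" for k
  proof (cases "k < N")
    case True
    have "norm (X k - x) / r ^ k \<le> (\<Sum>k<N. norm (X k - x) / r ^ k)"
      using True assms(1) by (intro member_le_sum) auto
    also have "\<dots> \<le> E"
      using assms(1) by (simp add: E_def)
    finally show ?thesis
      using assms(1) by (simp add: divide_le_eq)
  next
    case False
    then have "norm (X k - x) \<le> C * r ^ (k - N)"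
      using b[of "k - N"] by simp
    also have "\<dots> \<le> \<bar>C\<bar> * r ^ (k - N)"
      using assms(1) by (intro mult_right_mono) auto
    also have "\<dots> = \<bar>C\<bar> / r ^ N * r ^ k"
      using False assms(1) by (simp add: power_diff)
    also have "\<dots> \<le> E * r ^ k"
      using assms(1) S by (intro mult_right_mono) (auto simp: E_def)
    finally show ?thesis .
  qed
  moreover have "0 < E"
    using S assms(1) by (simp add: E_def add_nonneg_pos)
  ultimately show ?thesis
    using assms(1,2) unfolding R_linear_def by blast
qed

lemma R_linear_imp_LIMSEQ:
  assumes "R_linear X x"
  shows "X \<longlonglongrightarrow> x"
proof -
  obtain C q where q: "0 < q" "q < 1" and b: "\<And>k. norm (X k - x) \<le> C * q ^ k"
    using assms by (auto simp: R_linear_def)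
  have "(\<lambda>k. C * q ^ k) \<longlonglongrightarrow> 0"
    using q by (intro tendsto_mult_right_zero LIMSEQ_power_zero) auto
  then have "(\<lambda>k. X k - x) \<longlonglongrightarrow> 0"
    by (rule Lim_null_comparison[rotated]) (simp add: b)
  then show ?thesis
    by (simp add: LIM_zero_iff)
qed

section \<open>Contraction along building blocks near \<open>xbar\<close>\<close>

lemma rl_block_contraction:
  assumes l: "\<And>x. f x \<noteq> -\<infinity>" and sub: "A \<subseteq> int_dom f" "B \<subseteq> int_dom f"
    and m: "0 < m" and M: "0 < M"
    and low: "\<And>x y. x \<in> A \<union> B \<Longrightarrow> y \<in> A \<union> B \<Longrightarrow> m * (norm (x - y))\<^sup>2 \<le> breg f x y"
    and up: "\<And>x y. x \<in> A \<union> B \<Longrightarrow> y \<in> A \<union> B \<Longrightarrow> breg f x y \<le> M * (norm (x - y))\<^sup>2"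
    and tr: "rl_transversal f A B xbar" and tp: "rl_three_point f A B xbar"
  obtains \<rho> q where "0 < \<rho>" and "0 < q" and "q < 1"
    and "\<And>b a' b'. rl_block f A B b a' b' \<Longrightarrow> b \<in> ball xbar \<rho> \<Longrightarrow> a' \<in> ball xbar \<rho> \<Longrightarrow>
      b' \<in> ball xbar \<rho> \<Longrightarrow> breg f b' a' \<le> q * breg f b a'"
proof -
  obtain U \<alpha> where U: "open U" "xbar \<in> U" and \<alpha>: "0 < \<alpha>"
    and ang: "\<And>b a' b'. rl_block f A B b a' b' \<Longrightarrow> b \<in> U \<Longrightarrow> a' \<in> U \<Longrightarrow> b' \<in> U \<Longrightarrow>
           b \<noteq> a' \<Longrightarrow> a' \<noteq> b' \<Longrightarrow> \<alpha> < angle_between (b - a') (b' - a')"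
    using tr unfolding rl_transversal_def by metis
  obtain l \<delta> where l': "0 < l" "l < 1" and \<delta>: "0 < \<delta>"
    and three: "\<And>b a' b'. rl_block f A B b a' b' \<Longrightarrow> norm (b' - xbar) < \<delta> \<Longrightarrow> norm (a' - xbar) < \<delta> \<Longrightarrow>
           bregman f b a' \<ge> bregman f b' a' + ereal l * bregman f b b'"
    using tp unfolding rl_three_point_def by metis
  obtain \<epsilon> where \<epsilon>: "0 < \<epsilon>" "ball xbar \<epsilon> \<subseteq> U"
    using U open_contains_ball by blast
  \<comment> \<open>The angle estimate requires at most a right angle, so \<open>\<alpha>\<close> is
    truncated. The constant \<open>c\<close> arises from chaining \<open>D(b, b') \<ge> m |b -
    b'|\<^sup>2 \<ge> m (1 - cos \<beta>) |b - a'|\<^sup>2 \<ge> (m (1 - cos \<beta>) / M) D(b,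
    a')\<close> and multiplying by the three-point constant \<open>l\<close>.\<close>
  define \<beta> where "\<beta> = min \<alpha> (pi / 2)"
  define c where "c = l * m * (1 - cos \<beta>) / M"
  have \<beta>: "0 < \<beta>" "\<beta> \<le> pi / 2" "\<beta> \<le> \<alpha>"
    using \<alpha> by (auto simp: \<beta>_def)
  have "cos \<beta> < cos 0"
    using \<beta>(1,2) pi_gt_zero by (intro cos_monotone_0_pi) linarith+
  then have c: "0 < c"
    using l' m M by (simp add: c_def)
  have nn: "0 \<le> breg f x y" if "x \<in> A \<union> B" "y \<in> A \<union> B" for x y
    using low[OF that] m by (meson less_imp_le mult_nonneg_nonneg order_trans zero_le_power2)
  show thesis
  \<comment> \<open>The radius serves both the transversality neighborhood and the three-point
    inequality. The maximum with 1/2 keeps the rate strictly positive without comparing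
    \<open>m\<close> with \<open>M\<close>.\<close>
  proof (rule that[of "min \<epsilon> \<delta>" "max (1/2) (1 - c)"])
    fix b a' b' assume blk: "rl_block f A B b a' b'"
      and in_ball: "b \<in> ball xbar (min \<epsilon> \<delta>)" "a' \<in> ball xbar (min \<epsilon> \<delta>)" "b' \<in> ball xbar (min \<epsilon> \<delta>)"
    have mem: "b \<in> B" "a' \<in> A" "b' \<in> B"
      using blk by (auto simp: rl_block_def right_proj_def left_proj_def is_arg_min_def)
    have "ereal (breg f b a') \<ge> ereal (breg f b' a') + ereal l * ereal (breg f b b')"
    proof -
      have "norm (b' - xbar) < \<delta>" "norm (a' - xbar) < \<delta>"
        using in_ball by (simp_all add: dist_norm norm_minus_commute)
      moreover have "b \<in> int_dom f" "a' \<in> int_dom f" "b' \<in> int_dom f"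
        using mem sub by auto
      ultimately show ?thesis
        using three[OF blk] by (simp only: bregman_eq_breg[OF l])
    qed
    then have 3: "breg f b' a' + l * breg f b b' \<le> breg f b a'"
      by simp
    \<comment> \<open>Transversality says nothing about blocks with coinciding points. If
      \<open>b = a'\<close>, the three-point inequality forces the new distance to be at most 0; if
      \<open>b' = a'\<close>, it vanishes by definition.\<close>
    consider "b = a'" | "b' = a'" | "b \<noteq> a'" "b' \<noteq> a'" by blast
    then have "breg f b' a' \<le> (1 - c) * breg f b a' \<or> breg f b' a' \<le> 0"
    proof cases
      case 1
      then have "breg f b a' = 0" by (simp add: breg_def)
      moreover have "0 \<le> l * breg f b b'"
        using l' nn[of b b'] mem by (intro mult_nonneg_nonneg) auto
      ultimately show ?thesis using 3 by linarith
    next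
      case 2
      then show ?thesis by (simp add: breg_def)
    next
      case 3
      then have "\<beta> < angle_between (b - a') (b' - a')"
        using ang[OF blk] in_ball \<epsilon>(2) \<beta>(3) by force
      then have "(1 - cos \<beta>) * (norm (b - a'))\<^sup>2 \<le> (norm (b - b'))\<^sup>2"
        using angle_bound_norm_diff[of "b - a'" "b' - a'" \<beta>] 3 \<beta> by simp
      then have "m * ((1 - cos \<beta>) * (norm (b - a'))\<^sup>2) \<le> breg f b b'"
        using order_trans[OF mult_left_mono low[of b b']] mem m by simp
      moreover have "m * (1 - cos \<beta>) / M * breg f b a' \<le> m * (1 - cos \<beta>) / M * (M * (norm (b - a'))\<^sup>2)"
        using up[of b a'] mem m M by (intro mult_left_mono) auto
      ultimately have "m * (1 - cos \<beta>) / M * breg f b a' \<le> breg f b b'"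
        using M by (simp add: mult.assoc)
      then have "l * (m * (1 - cos \<beta>) / M * breg f b a') \<le> l * breg f b b'"
        using l' by (intro mult_left_mono) auto
      then have "c * breg f b a' \<le> l * breg f b b'"
        by (simp add: c_def mult.assoc)
      then show ?thesis
        using \<open>breg f b' a' + l * breg f b b' \<le> breg f b a'\<close> by (simp add: algebra_simps)
    qed
    moreover have "(1 - c) * breg f b a' \<le> max (1/2) (1 - c) * breg f b a'"
      "0 \<le> max (1/2) (1 - c) * breg f b a'"
      using nn[of b a'] mem by (auto intro!: mult_right_mono mult_nonneg_nonneg)
    ultimately show "breg f b' a' \<le> max (1/2) (1 - c) * breg f b a'"
      by linarith
  qed (use \<epsilon> \<delta> c in auto)
qed

section \<open>Trapping an alternating sequence and its convergence\<close>

theorem corollary9p4: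
  fixes f :: "'a::euclidean_space \<Rightarrow> ereal" and A B :: "'a set" and xbar :: 'a
  assumes "legendre_type f" and "C2_on_int_dom f" and "hess_pos_def f"
    and "A \<noteq> {}" and "closed A" and "bounded A" and "A \<subseteq> int_dom f"
    and "B \<noteq> {}" and "closed B" and "bounded B" and "B \<subseteq> int_dom f"
    and "xbar \<in> A \<inter> B"
    and "rl_transversal f A B xbar"
    and "rl_three_point f A B xbar"
  shows "\<exists>V. open V \<and> xbar \<in> V \<and>
    (\<forall>a b. bregman_alternating f A B a b \<longrightarrow> (\<exists>k. a k \<in> V \<or> b k \<in> V) \<longrightarrow>
       (\<exists>x\<in>A \<inter> B. a \<longlonglongrightarrow> x \<and> b \<longlonglongrightarrow> x \<and> R_linear a x \<and> R_linear b x))"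
proof -
  have l: "\<And>x. f x \<noteq> -\<infinity>" and cvx: "ereal_convex f"
    using assms(1) by (auto simp: legendre_type_def)
  define K where "K = convex hull (A \<union> B)"
  have "compact (A \<union> B)"
    using assms(5,6,9,10) by (simp add: compact_eq_bounded_closed closed_Un)
  then have "compact K" "convex K"
    by (simp_all add: K_def compact_convex_hull)
  moreover have "K \<subseteq> int_dom f"
    unfolding K_def using assms(7,11) convex_int_dom[OF cvx l] by (intro hull_minimal) auto
  moreover have ABK: "A \<union> B \<subseteq> K"
    unfolding K_def by (rule hull_subset)
  moreover have "K \<noteq> {}"
    using ABK assms(4) by blast
  ultimately obtain m M where m: "0 < m" and M: "0 < M"
    and lowK: "\<And>x y. x \<in> K \<Longrightarrow> y \<in> K \<Longrightarrow> m * (norm (x - y))\<^sup>2 \<le> breg f x y"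
    and upK: "\<And>x y. x \<in> K \<Longrightarrow> y \<in> K \<Longrightarrow> breg f x y \<le> M * (norm (x - y))\<^sup>2"
    using breg_bounds[OF assms(2,3)] by metis
  have low: "m * (norm (x - y))\<^sup>2 \<le> breg f x y" and up: "breg f x y \<le> M * (norm (x - y))\<^sup>2"
    if "x \<in> A \<union> B" "y \<in> A \<union> B" for x y
    using that ABK by (auto intro!: lowK upK)
  obtain \<rho> q where \<rho>: "0 < \<rho>" and q: "0 < q" "q < 1"
    and contr: "\<And>b a' b'. rl_block f A B b a' b' \<Longrightarrow> b \<in> ball xbar \<rho> \<Longrightarrow> a' \<in> ball xbar \<rho> \<Longrightarrow>
      b' \<in> ball xbar \<rho> \<Longrightarrow> breg f b' a' \<le> q * breg f b a'"
    using rl_block_contraction[OF l assms(7,11) m M low up assms(13,14)] by metis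
  \<comment> \<open>\<open>s\<close> turns a bound \<open>M * e\<^sup>2\<close> on the Bregman
    distance into the bound \<open>s * e\<close> on the norm, and \<open>r\<close> is the norm rate
    matching the rate \<open>q\<close> of the Bregman distance. \<open>T * \<epsilon>\<close> is the
    sum of all steps \<open>2 * s * \<epsilon> * r ^ i\<close>. The radius \<open>\<rho>\<close>
    must cover the starting offset \<open>(1 + 2 * s) * \<epsilon>\<close>, the travel
    \<open>T * \<epsilon>\<close> and one further block \<open>2 * s * \<epsilon>\<close>; the
    remaining \<open>\<epsilon>\<close> gives strictness.\<close>
  define s where "s = sqrt (M / m)"
  define r where "r = sqrt q"
  define T where "T = 2 * s / (1 - r)"
  define \<epsilon> where "\<epsilon> = \<rho> / (2 + 4 * s + T)"
  have s: "0 < s"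
    using m M by (simp add: s_def)
  have r: "0 < r" "r < 1" "r\<^sup>2 = q"
    using q by (auto simp: r_def)
  have T: "0 < T"
    using s r by (simp add: T_def)
  have \<epsilon>: "0 < \<epsilon>" and \<rho>_eq: "\<rho> = \<epsilon> * (2 + 4 * s + T)"
    using \<rho> s T by (simp_all add: \<epsilon>_def)
  have close: "norm (x - y) \<le> s * e"
    if "x \<in> A \<union> B" "y \<in> A \<union> B" "breg f x y \<le> M * e\<^sup>2" "0 \<le> e" for x y e
  proof (rule power2_le_imp_le)
    have "m * (norm (x - y))\<^sup>2 \<le> M * e\<^sup>2"
      using low that by force
    then show "(norm (x - y))\<^sup>2 \<le> (s * e)\<^sup>2"
      using m M by (simp add: s_def power_mult_distrib field_simps)
  qed (use s that in auto)
  have "\<exists>x\<in>A \<inter> B. a \<longlonglongrightarrow> x \<and> b \<longlonglongrightarrow> x \<and> R_linear a x \<and> R_linear b x"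
    if alt: "bregman_alternating f A B a b" and enter: "a k \<in> ball xbar \<epsilon> \<or> b k \<in> ball xbar \<epsilon>" for a b k
  proof -
    have aA: "a n \<in> A" and bB: "b n \<in> B" and blk: "rl_block f A B (b n) (a (Suc n)) (b (Suc n))" for n
      using alt by (auto simp: bregman_alternating_def rl_block_def)
    \<comment> \<open>This and its counterpart \<open>right\<close> are used in two ways: with
      \<open>xbar\<close> as competitor to control the iterates on entry, and with the previous
      iterate as competitor to see that the Bregman distance never increases along the
      sequence.\<close>
    have left: "breg f (b n) (a n) \<le> breg f y (a n)" if "y \<in> B" for n y
    proof -
      have "\<not> bregman f y (a n) < bregman f (b n) (a n)"
        using alt that by (auto simp: bregman_alternating_def left_proj_def is_arg_min_def)
      moreover have "y \<in> int_dom f" "a n \<in> int_dom f" "b n \<in> int_dom f" "a (Suc n) \<in> int_dom f"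
        using that aA bB assms(7,11) by auto
      ultimately show ?thesis
        by (simp add: bregman_eq_breg[OF l] not_less)
    qed
    have right: "breg f (b n) (a (Suc n)) \<le> breg f (b n) y" if "y \<in> A" for n y
    proof -
      have "\<not> bregman f (b n) y < bregman f (b n) (a (Suc n))"
        using alt that by (auto simp: bregman_alternating_def right_proj_def is_arg_min_def)
      moreover have "y \<in> int_dom f" "a n \<in> int_dom f" "b n \<in> int_dom f" "a (Suc n) \<in> int_dom f"
        using that aA bB assms(7,11) by auto
      ultimately show ?thesis
        by (simp add: bregman_eq_breg[OF l] not_less)
    qed
    have xA: "xbar \<in> A" and xB: "xbar \<in> B"
      using assms(12) by auto
    have near: "breg f x y \<le> M * \<epsilon>\<^sup>2"
      if "x \<in> A \<union> B" "y \<in> A \<union> B" "norm (x - y) < \<epsilon>" for x y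
    proof -
      have "(norm (x - y))\<^sup>2 \<le> \<epsilon>\<^sup>2"
        using that by (intro power_mono) auto
      then show ?thesis
        using order_trans[OF up[OF that(1,2)] mult_left_mono] M by simp
    qed
    \<comment> \<open>If \<open>a k\<close> enters, projecting it onto \<open>B\<close> controls
      \<open>b k\<close>, so \<open>N = k\<close>. If only \<open>b k\<close> is known to be close,
      \<open>a k\<close> may be far away, so the control starts one index later, with
      \<open>N = Suc k\<close>.\<close>
    obtain N where N: "norm (b N - xbar) \<le> (1 + 2 * s) * \<epsilon>" "breg f (b N) (a N) \<le> M * \<epsilon>\<^sup>2"
    proof (cases "a k \<in> ball xbar \<epsilon>")
      case True
      then have n: "norm (xbar - a k) < \<epsilon>"
        by (simp add: dist_norm)
      then have D: "breg f (b k) (a k) \<le> M * \<epsilon>\<^sup>2"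
        using left[OF xB, of k] near[of xbar "a k"] xA aA by force
      then have "norm (b k - a k) \<le> s * \<epsilon>"
        using close aA bB \<epsilon> by simp
      then have "norm (b k - xbar) \<le> \<epsilon> + s * \<epsilon>"
        using n norm_triangle_ineq4[of "b k - a k" "xbar - a k"] by simp
      then have "norm (b k - xbar) \<le> (1 + 2 * s) * \<epsilon>"
        using mult_pos_pos[OF s \<epsilon>] unfolding distrib_right mult.assoc by linarith
      with D show ?thesis
        using that by blast
    next
      case False
      then have n: "norm (b k - xbar) < \<epsilon>"
        using enter by (simp add: dist_norm norm_minus_commute)
      then have D: "breg f (b k) (a (Suc k)) \<le> M * \<epsilon>\<^sup>2"
        using right[OF xA, of k] near[of "b k" xbar] xA bB by force
      then have D': "breg f (b (Suc k)) (a (Suc k)) \<le> M * \<epsilon>\<^sup>2"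
        using left[OF bB[of k], of "Suc k"] by simp
      have "norm (b k - a (Suc k)) \<le> s * \<epsilon>" "norm (b (Suc k) - a (Suc k)) \<le> s * \<epsilon>"
        using close[OF _ _ D] close[OF _ _ D'] aA bB \<epsilon> by auto
      then have "norm (b (Suc k) - b k) \<le> 2 * (s * \<epsilon>)"
        using norm_triangle_ineq4[of "b (Suc k) - a (Suc k)" "b k - a (Suc k)"] by simp
      then have "norm (b (Suc k) - xbar) \<le> (1 + 2 * s) * \<epsilon>"
        using n norm_triangle_ineq[of "b (Suc k) - b k" "b k - xbar"] by (simp add: algebra_simps)
      with D' show ?thesis
        using that by blast
    qed
    \<comment> \<open>Only monotonicity of the Bregman distance enters here, not the contraction.
      The next block can therefore be located before the contraction, which is valid only near
      \<open>xbar\<close>, is applied to it.\<close>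
    have step: "norm (b (Suc n) - a (Suc n)) \<le> s * (\<epsilon> * r ^ i)" "norm (b n - a (Suc n)) \<le> s * (\<epsilon> * r ^ i)"
      "norm (b (Suc n) - b n) \<le> 2 * s * \<epsilon> * r ^ i"
      if D: "breg f (b n) (a n) \<le> M * (\<epsilon> * r ^ i)\<^sup>2" for n i
    proof -
      have D1: "breg f (b n) (a (Suc n)) \<le> M * (\<epsilon> * r ^ i)\<^sup>2"
        using D right[OF aA[of n], of n] by simp
      have D2: "breg f (b (Suc n)) (a (Suc n)) \<le> M * (\<epsilon> * r ^ i)\<^sup>2"
        using D1 left[OF bB[of n], of "Suc n"] by simp
      show 1: "norm (b (Suc n) - a (Suc n)) \<le> s * (\<epsilon> * r ^ i)"
        and 2: "norm (b n - a (Suc n)) \<le> s * (\<epsilon> * r ^ i)"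
        using close[OF _ _ D1] close[OF _ _ D2] aA bB \<epsilon> r(1) by auto
      show "norm (b (Suc n) - b n) \<le> 2 * s * \<epsilon> * r ^ i"
        using 1 2 norm_triangle_ineq4[of "b (Suc n) - a (Suc n)" "b n - a (Suc n)"] by simp
    qed
    \<comment> \<open>The two bounds have to be proved together: the displacement bound, a partial
      geometric sum of the steps, keeps the next block in the ball of radius \<open>\<rho>\<close>,
      and the contraction there yields the decay that bounds the next step.\<close>
    have inv: "norm (b (i + N) - b N) \<le> T * \<epsilon> * (1 - r ^ i) \<and>
        breg f (b (i + N)) (a (i + N)) \<le> M * (\<epsilon> * r ^ i)\<^sup>2" for i
    proof (induction i)
      case 0
      then show ?case using N by simp
    next
      case (Suc i)
      let ?b = "b (i + N)" and ?a' = "a (Suc (i + N))" and ?b' = "b (Suc (i + N))"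
      have D: "breg f ?b (a (i + N)) \<le> M * (\<epsilon> * r ^ i)\<^sup>2"
        using Suc by simp
      have ri: "0 \<le> r ^ i" "r ^ i \<le> 1"
        using r by (auto intro: power_le_one)
      have "T * \<epsilon> * (1 - r ^ i) \<le> T * \<epsilon>"
        using T \<epsilon> ri by (intro mult_left_le) auto
      then have "norm (?b - b N) \<le> T * \<epsilon>"
        using Suc by linarith
      then have nb: "norm (?b - xbar) \<le> T * \<epsilon> + (1 + 2 * s) * \<epsilon>"
        using N(1) norm_triangle_ineq[of "?b - b N" "b N - xbar"] by simp
      have se: "s * (\<epsilon> * r ^ i) \<le> s * \<epsilon>" "0 < s * \<epsilon>"
        using s \<epsilon> ri by (auto intro: mult_left_le)
      have na: "norm (?a' - xbar) \<le> s * \<epsilon> + (T * \<epsilon> + (1 + 2 * s) * \<epsilon>)"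
        using nb step(2)[OF D] se norm_triangle_ineq4[of "?b - xbar" "?b - ?a'"] by simp
      have nb': "norm (?b' - xbar) \<le> 2 * (s * \<epsilon>) + (T * \<epsilon> + (1 + 2 * s) * \<epsilon>)"
        using na step(1)[OF D] se norm_triangle_ineq[of "?b' - ?a'" "?a' - xbar"] by simp
      have "2 * (s * \<epsilon>) + (T * \<epsilon> + (1 + 2 * s) * \<epsilon>) < \<rho>"
        using \<epsilon> by (simp add: \<rho>_eq algebra_simps)
      then have "?b \<in> ball xbar \<rho>" "?a' \<in> ball xbar \<rho>" "?b' \<in> ball xbar \<rho>"
        using nb na nb' se(2) by (simp_all add: dist_norm norm_minus_commute)
      then have "breg f ?b' ?a' \<le> q * breg f ?b ?a'"
        using contr[OF blk] by blast
      also have "\<dots> \<le> q * (M * (\<epsilon> * r ^ i)\<^sup>2)"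
        using D right[OF aA[of "i + N"], of "i + N"] q by (intro mult_left_mono) auto
      also have "\<dots> = M * (\<epsilon> * r ^ Suc i)\<^sup>2"
        by (simp add: power_mult_distrib r(3))
      finally have 1: "breg f ?b' ?a' \<le> M * (\<epsilon> * r ^ Suc i)\<^sup>2" .
      have "T * \<epsilon> * (1 - r ^ Suc i) = 2 * s * \<epsilon> * r ^ i + T * \<epsilon> * (1 - r ^ i)"
        using r(2) by (simp add: T_def field_simps)
      then have "norm (?b' - b N) \<le> T * \<epsilon> * (1 - r ^ Suc i)"
        using Suc step(3)[OF D] norm_triangle_ineq[of "?b' - ?b" "?b - b N"] by simp
      with 1 show ?case by simp
    qed
    obtain x where bx: "(\<lambda>i. b (i + N)) \<longlonglongrightarrow> x"
      and rate: "\<And>i. norm (b (i + N) - x) \<le> 2 * s * \<epsilon> / (1 - r) * r ^ i"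
      using geometric_steps_converge[of r "\<lambda>i. b (i + N)" "2 * s * \<epsilon>"] r step(3) inv by auto
    \<comment> \<open>The gap between \<open>a\<close> and \<open>b\<close> decays at the same rate
      \<open>r\<close>, so \<open>a\<close> inherits both the limit and the speed of
      \<open>b\<close>.\<close>
    have "norm (a (i + N) - x) \<le> (s * \<epsilon> + 2 * s * \<epsilon> / (1 - r)) * r ^ i" for i
    proof -
      have "norm (b (i + N) - a (i + N)) \<le> s * (\<epsilon> * r ^ i)"
        using inv[of i] close[of "b (i + N)" "a (i + N)" "\<epsilon> * r ^ i"] aA bB \<epsilon> r(1) by simp
      then show ?thesis
        using rate[of i] norm_triangle_ineq4[of "b (i + N) - x" "b (i + N) - a (i + N)"]
        by (simp add: distrib_right mult.assoc)
    qed
    then have Ra: "R_linear a x"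
      using R_linear_shift r(1,2) by blast
    have Rb: "R_linear b x"
      using R_linear_shift r(1,2) rate by blast
    have lim: "a \<longlonglongrightarrow> x" "b \<longlonglongrightarrow> x"
      using Ra Rb by (auto intro: R_linear_imp_LIMSEQ)
    then have "x \<in> A \<inter> B"
      using closed_sequentially assms(5,9) aA bB by blast
    with lim Ra Rb show ?thesis by blast
  qed
  then show ?thesis
    using \<epsilon> by (intro exI[of _ "ball xbar \<epsilon>"]) auto
qed

end
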